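(* Let $\mathcal{D}$ be a Ryser design of order $v$ and index $\lambda$, with replication numbers $r_1>r_2$, let $e_1$ be the number of points with replication number $r_1$, and let $D=e_1-r_2$. (a) If $D\le -1$, then $v\ge 4\lambda-1$. (b) If $D\ge 0$, then $\lambda^2+\lambda+1\ge v$.
   Context: A Ryser design of order $v$ and index $\lambda$ is a pair $(X,L)$ where $X$ is a set of $v$ points and $L$ is a collection of $v$ subsets (blocks) of $X$ such that any two distinct blocks meet in exactly $\lambda$ points, every block has size $>\lambda$, and there exist two blocks of different sizes. It is known that there are integers $r_1>r_2$ with $r_1+r_2=v+1$ such that every point lies in exactly $r_1$ or exactly $r_2$ blocks (the replication numbers). *)

theory Defs
  imports Main
begin

text \<open>Positivity of \<open>\<lambda>\<close> is not required separately: for \<open>\<lambda> = 0\<close> the \<open>v\<close> blocks would be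
  nonempty and pairwise disjoint subsets of a \<open>v\<close>-set, hence all singletons, contradicting the last
  condition.\<close>

definition ryser_design :: "'a set \<Rightarrow> 'a set set \<Rightarrow> nat \<Rightarrow> nat \<Rightarrow> bool" where
  "ryser_design X L v lam \<longleftrightarrow>
     finite X \<and> card X = v \<and>
     L \<subseteq> Pow X \<and> card L = v \<and>
     (\<forall>A\<in>L. \<forall>B\<in>L. A \<noteq> B \<longrightarrow> card (A \<inter> B) = lam) \<and>
     (\<forall>B\<in>L. card B > lam) \<and>
     (\<exists>A\<in>L. \<exists>B\<in>L. card A \<noteq> card B)"

definition replication :: "'a set set \<Rightarrow> 'a \<Rightarrow> nat" where
  "replication L x = card {B \<in> L. x \<in> B}"

text \<open>In a Ryser design both values are attained: if all points had the same replication number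
  \<open>r\<close>, counting incidences of the points of a block \<open>B\<close> would give
  \<open>card B * (r - 1) = (v - 1) * \<lambda>\<close> for every \<open>B\<close>, so all blocks would have the same size.
  Hence \<open>r1\<close> and \<open>r2\<close> are uniquely determined by this predicate.\<close>

definition replication_numbers :: "'a set \<Rightarrow> 'a set set \<Rightarrow> nat \<Rightarrow> nat \<Rightarrow> bool" where
  "replication_numbers X L r1 r2 \<longleftrightarrow>
     r1 > r2 \<and> r1 + r2 = card X + 1 \<and>
     (\<forall>x\<in>X. replication L x = r1 \<or> replication L x = r2)"

end

theory Submission
  imports Defs
begin

text \<open>Double counting gives \<open>\<Sum>\<^sub>x r(x) \<ge> v (\<lambda> + 1)\<close> and
  \<open>\<Sum>\<^sub>x r(x) (r(x) - 1) = \<lambda> v (v - 1)\<close>. Substituting \<open>e\<^sub>1 = r\<^sub>2 + D\<close>, the second identity becomes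
  \<open>\<lambda> (v - 1) = r\<^sub>2 (r\<^sub>1 - 1) + D (r\<^sub>1 - r\<^sub>2)\<close>. If \<open>D \<le> -1\<close>, the right-hand side is at most
  \<open>r\<^sub>1 (r\<^sub>2 - 1) \<le> (v\<^bsup>2\<^esup> - 4) / 4\<close>. If \<open>D \<ge> 0\<close> and \<open>r\<^sub>2 > \<lambda>\<close>, dropping the term in \<open>D\<close> suffices. If
  \<open>2 \<le> r\<^sub>2 \<le> \<lambda>\<close>, rewrite the identity as
  \<open>(D - (\<lambda> - r\<^sub>2)) (r\<^sub>1 - r\<^sub>2) = (2 \<lambda> - r\<^sub>2) (r\<^sub>2 - 1)\<close>: the first factor is a positive integer, so
  \<open>r\<^sub>1 - r\<^sub>2\<close> is at most the right-hand side. The bound on \<open>\<Sum>\<^sub>x r(x)\<close> excludes \<open>r\<^sub>2 \<le> 1\<close>.\<close>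

lemma replication_eq_sum:
  assumes "finite L"
  shows "replication L x = (\<Sum>B\<in>L. if x \<in> B then 1 else 0)"
  using assms by (simp add: replication_def sum.If_cases Collect_conj_eq)

lemma sum_replication:
  assumes "finite X" "L \<subseteq> Pow X"
  shows "(\<Sum>x\<in>X. replication L x) = (\<Sum>B\<in>L. card B)"
proof -
  have fL: "finite L" using assms by (meson finite_Pow_iff finite_subset)
  have "(\<Sum>x\<in>X. replication L x) = (\<Sum>B\<in>L. \<Sum>x\<in>X. if x \<in> B then 1 else 0)"
    by (simp only: replication_eq_sum[OF fL] sum.swap[of _ X])
  also have "\<dots> = (\<Sum>B\<in>L. card B)"
  proof (rule sum.cong[OF refl])
    fix B assume "B \<in> L"
    then have "X \<inter> B = B" using assms(2) by auto
    then show "(\<Sum>x\<in>X. if x \<in> B then 1 else 0) = card B"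
      using assms(1) by (simp add: sum.If_cases)
  qed
  finally show ?thesis .
qed

text \<open>Both sides count triples \<open>(x, A, B)\<close> with \<open>x\<close> in
  \<open>A \<inter> B\<close>; the diagonal pairs \<open>A = B\<close> are included.\<close>

lemma sum_replication_square:
  assumes "finite X" "L \<subseteq> Pow X"
  shows "(\<Sum>x\<in>X. (replication L x)\<^sup>2) = (\<Sum>A\<in>L. \<Sum>B\<in>L. card (A \<inter> B))"
proof -
  have fL: "finite L" using assms by (meson finite_Pow_iff finite_subset)
  have "replication L x ^ 2 = (\<Sum>A\<in>L. \<Sum>B\<in>L. if x \<in> A \<inter> B then 1 else 0)" for x
    unfolding replication_eq_sum[OF fL] power2_eq_square sum_product
    by (intro sum.cong) auto
  then have "(\<Sum>x\<in>X. (replication L x)\<^sup>2) = (\<Sum>A\<in>L. \<Sum>B\<in>L. \<Sum>x\<in>X. if x \<in> A \<inter> B then 1 else 0)"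
    by (simp only: sum.swap[of _ X])
  also have "\<dots> = (\<Sum>A\<in>L. \<Sum>B\<in>L. card (A \<inter> B))"
  proof (intro sum.cong[OF refl])
    fix A B assume "A \<in> L" "B \<in> L"
    then have "X \<inter> {x. x \<in> A \<inter> B} = A \<inter> B" using assms(2) by auto
    then show "(\<Sum>x\<in>X. if x \<in> A \<inter> B then 1 else 0) = card (A \<inter> B)"
      using assms(1) by (simp only: sum.If_cases) simp
  qed
  finally show ?thesis .
qed

lemma ryser_design_sum_replication_ge:
  assumes "ryser_design X L v lam"
  shows "(\<Sum>x\<in>X. replication L x) \<ge> v * (lam + 1)"
proof -
  have "(\<Sum>B\<in>L. lam + 1) \<le> (\<Sum>B\<in>L. card B)"
    using assms by (intro sum_mono) (auto simp: ryser_design_def Suc_le_eq)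
  then show ?thesis
    using assms sum_replication[of X L] by (simp add: ryser_design_def)
qed

text \<open>The diagonal pairs contribute the block sizes, which add up to the sum of the
  replication numbers; each of the \<open>v * (v - 1)\<close> ordered pairs of distinct blocks
  contributes \<open>lam\<close>.\<close>

lemma ryser_design_sum_replication_square:
  assumes "ryser_design X L v lam"
  shows "(\<Sum>x\<in>X. (replication L x)\<^sup>2) = (\<Sum>x\<in>X. replication L x) + v * ((v - 1) * lam)"
proof -
  have fX: "finite X" and LX: "L \<subseteq> Pow X" and cL: "card L = v"
    and inter: "\<And>A B. A \<in> L \<Longrightarrow> B \<in> L \<Longrightarrow> A \<noteq> B \<Longrightarrow> card (A \<inter> B) = lam"
    using assms by (auto simp: ryser_design_def)
  have fL: "finite L" using fX LX by (meson finite_Pow_iff finite_subset)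
  have "(\<Sum>B\<in>L. card (A \<inter> B)) = card A + (v - 1) * lam" if "A \<in> L" for A
  proof -
    have "(\<Sum>B\<in>L - {A}. card (A \<inter> B)) = (\<Sum>B\<in>L - {A}. lam)"
      using inter that by (intro sum.cong) auto
    then show ?thesis
      using that fL cL by (simp add: sum.remove[of L A])
  qed
  then show ?thesis
    using cL by (simp add: sum_replication_square[OF fX LX] sum_replication[OF fX LX] sum.distrib)
qed

lemma sum_two_valued:
  fixes g :: "nat \<Rightarrow> int"
  assumes "finite X" "\<forall>x\<in>X. f x = a \<or> f x = b"
  shows "(\<Sum>x\<in>X. g (f x)) = int (card {x\<in>X. f x = a}) * g a
           + (int (card X) - int (card {x\<in>X. f x = a})) * g b"
proof -
  let ?A = "{x\<in>X. f x = a}"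
  have "(\<Sum>x\<in>X. g (f x)) = (\<Sum>x\<in>?A. g (f x)) + (\<Sum>x\<in>X - ?A. g (f x))"
    using assms(1) by (simp add: sum.subset_diff[of ?A X])
  also have "(\<Sum>x\<in>?A. g (f x)) = (\<Sum>x\<in>?A. g a)" by (intro sum.cong) auto
  also have "(\<Sum>x\<in>X - ?A. g (f x)) = (\<Sum>x\<in>X - ?A. g b)"
    using assms(2) by (intro sum.cong) auto
  also have "card (X - ?A) = card X - card ?A" using assms(1) by (intro card_Diff_subset) auto
  moreover have "card ?A \<le> card X" using assms(1) by (intro card_mono) auto
  ultimately show ?thesis by (simp add: of_nat_diff)
qed

lemma order_bound_negative:
  fixes v lam r1 r2 D :: int
  assumes "lam * (v - 1) = r2 * (r1 - 1) + D * (r1 - r2)"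
    and "r1 + r2 = v + 1" "r1 > r2" "v \<ge> 2" "D \<le> -1"
  shows "4 * lam \<le> v"
proof -
  have "D * (r1 - r2) \<le> (-1) * (r1 - r2)"
    using assms by (intro mult_right_mono) auto
  then have le: "lam * (v - 1) \<le> r1 * (r2 - 1)"
    using assms(1) by (simp add: algebra_simps)
  have "2 * 2 \<le> (r1 - r2 + 1) * (r1 - r2 + 1)"
    using assms(3) by (intro mult_mono) auto
  \<comment> \<open>The factors \<open>r1\<close> and \<open>r2 - 1\<close> add up to
    \<open>v\<close>, so four times their product is \<open>v^2\<close> minus the square of their
    difference, which is at least 4.\<close>
  moreover have "(v + 1) * (v - 1) - 4 * (r1 * (r2 - 1)) = (r1 - r2 + 1) * (r1 - r2 + 1) - 1"
    unfolding assms(2)[symmetric, THEN eq_diff_eq[THEN iffD2]] by (simp add: algebra_simps)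
  ultimately have "(4 * lam) * (v - 1) < (v + 1) * (v - 1)"
    using le by linarith
  then have "4 * lam < v + 1"
    using assms(4) by (simp add: mult_less_cancel_right)
  then show ?thesis by simp
qed

lemma order_bound_nonnegative:
  fixes v lam r1 r2 D :: int
  assumes eq: "lam * (v - 1) = r2 * (r1 - 1) + D * (r1 - r2)"
    and "r1 + r2 = v + 1" "r1 > r2" "r2 \<ge> 2" "D \<ge> 0"
  shows "v \<le> lam\<^sup>2 + lam + 1"
proof -
  define p q where "p = r1 - 1" and "q = r2 - 1"
  have r: "r1 = p + 1" "r2 = q + 1" "v = p + q + 1" and pq: "p > q" "q \<ge> 1"
    using assms by (auto simp: p_def q_def)
  have eq': "lam * (p + q) = (q + 1) * p + D * (p - q)"
    using eq r by (simp add: algebra_simps)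
  have "p + q \<le> lam\<^sup>2 + lam"
  proof (cases "q \<ge> lam")
    case True
    \<comment> \<open>\<open>s\<close> is the excess of \<open>r2\<close> over \<open>lam\<close>.
      Dropping the term in \<open>D\<close> then leaves \<open>s * p \<le> lam * q\<close>.\<close>
    define s where "s = q + 1 - lam"
    have s1: "s \<ge> 1" and q: "q = s + lam - 1" using True by (auto simp: s_def)
    have "D * (p - q) \<ge> 0" using assms(5) pq by simp
    then have sp: "s * p \<le> lam * q"
      using eq' unfolding s_def by (simp add: algebra_simps)
    have "s < lam"
    proof (rule ccontr)
      assume "\<not> s < lam"
      then have "lam * q \<le> s * q" using pq by (intro mult_right_mono) auto
      also have "\<dots> < s * p" using s1 pq by (intro mult_strict_left_mono) auto
      finally show False using sp by simp
    qed
    moreover have "(lam - 1) * (lam - 1) \<ge> 0" by simp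
    ultimately have "0 \<le> lam\<^sup>2 - s - lam"
      by (simp add: power2_eq_square algebra_simps)
    \<comment> \<open>With \<open>q = s + lam - 1\<close>, this product is exactly
      \<open>s * (lam^2 + lam) - (s + lam) * q\<close>.\<close>
    then have "0 \<le> (s - 1) * (lam\<^sup>2 - s - lam)" using s1 by simp
    then have "(s + lam) * q \<le> s * (lam\<^sup>2 + lam)"
      unfolding q by (simp add: power2_eq_square algebra_simps)
    moreover have "s * (p + q) \<le> (s + lam) * q" using sp by (simp add: algebra_simps)
    ultimately have "s * (p + q) \<le> s * (lam\<^sup>2 + lam)" by linarith
    then show ?thesis using s1 by simp
  next
    case False
    \<comment> \<open>Subtracting \<open>(lam - r2) * (p - q)\<close> from both sides removes
      \<open>p\<close> from the right-hand side, so that \<open>p - q\<close> can be bounded in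
      terms of \<open>lam\<close> and \<open>q\<close>.\<close>
    have eq2: "(D - (lam - (q + 1))) * (p - q) = (2 * lam - (q + 1)) * q"
      using eq' by (simp add: algebra_simps)
    moreover have "(2 * lam - (q + 1)) * q > 0" using False pq by simp
    ultimately have "D - (lam - (q + 1)) > 0"
      using pq by (metis diff_gt_0_iff_gt zero_less_mult_pos2)
    then have "1 * (p - q) \<le> (D - (lam - (q + 1))) * (p - q)"
      using pq by (intro mult_right_mono) auto
    \<comment> \<open>This expression is the slack
      \<open>lam^2 + lam - (2 * lam - q + 1) * q\<close> in the bound on
      \<open>p + q\<close>.\<close>
    moreover have "0 \<le> (lam - q) * (lam - q) + (lam - q)" using False by simp
    ultimately show ?thesis
      using eq2 by (simp add: power2_eq_square algebra_simps)
  qed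
  then show ?thesis using r by simp
qed

theorem theorem1p12:
  fixes X :: "'a set" and L :: "'a set set" and v lam r1 r2 e1 :: nat and D :: int
  assumes "ryser_design X L v lam"
    and "replication_numbers X L r1 r2"
    and "e1 = card {x \<in> X. replication L x = r1}"
    and "D = int e1 - int r2"
  shows "(D \<le> -1 \<longrightarrow> int v \<ge> 4 * int lam - 1) \<and> (D \<ge> 0 \<longrightarrow> lam^2 + lam + 1 \<ge> v)"
proof -
  have fX: "finite X" and cX: "card X = v" and LX: "L \<subseteq> Pow X" and cL: "card L = v"
    using assms(1) by (auto simp: ryser_design_def)
  have fL: "finite L" using fX LX by (meson finite_Pow_iff finite_subset)
  obtain A B where "A \<in> L" "B \<in> L" "card A \<noteq> card B"
    using assms(1) by (auto simp: ryser_design_def)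
  then have "card {A, B} \<le> card L" "card {A, B} = 2"
    using fL by (auto intro!: card_mono simp: card_2_iff)
  then have v2: "v \<ge> 2" using cL by simp
  have r: "r1 > r2" "r1 + r2 = v + 1"
    and vals: "\<forall>x\<in>X. replication L x = r1 \<or> replication L x = r2"
    using assms(2) cX by (auto simp: replication_numbers_def)
  define V l R1 R2 where "V = int v" and "l = int lam" and "R1 = int r1" and "R2 = int r2"
  note ints = V_def l_def R1_def R2_def
  have R: "R1 > R2" "R1 + R2 = V + 1" "V \<ge> 2" "l \<ge> 0" "R2 \<ge> 0"
    using r v2 by (auto simp: ints)
  have e: "int e1 = R2 + D" using assms(4) by (simp add: ints)
  have sum1: "int (\<Sum>x\<in>X. replication L x) = (R2 + D) * R1 + (V - (R2 + D)) * R2"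
    using sum_two_valued[OF fX vals, of int] assms(3) e cX by (simp add: ints)
  have sum2: "int (\<Sum>x\<in>X. (replication L x)\<^sup>2) = (R2 + D) * R1\<^sup>2 + (V - (R2 + D)) * R2\<^sup>2"
    using sum_two_valued[OF fX vals, of "\<lambda>n. (int n)\<^sup>2"] assms(3) e cX by (simp add: ints)
  have ge: "(R2 + D) * R1 + (V - (R2 + D)) * R2 \<ge> V * (l + 1)"
    unfolding sum1[symmetric] using ryser_design_sum_replication_ge[OF assms(1)]
    unfolding ints by (metis of_nat_1 of_nat_add of_nat_le_iff of_nat_mult)
  have "int (\<Sum>x\<in>X. (replication L x)\<^sup>2) = int (\<Sum>x\<in>X. replication L x) + V * ((V - 1) * l)"
    unfolding ryser_design_sum_replication_square[OF assms(1)]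
    using v2 by (simp add: ints of_nat_diff)
  then have sq: "(R2 + D) * R1\<^sup>2 + (V - (R2 + D)) * R2\<^sup>2
      = (R2 + D) * R1 + (V - (R2 + D)) * R2 + V * ((V - 1) * l)"
    unfolding sum1 sum2 .
  have V: "V = R1 + R2 - 1" using R by simp
  \<comment> \<open>Once \<open>V\<close> is replaced by \<open>R1 + R2 - 1\<close>, the difference
    of the two sums in \<open>sq\<close> has the factor \<open>V\<close>, which can be
    cancelled.\<close>
  have "V * (l * (V - 1)) = V * (R2 * (R1 - 1) + D * (R1 - R2))"
    using sq unfolding V by (simp add: power2_eq_square algebra_simps)
  then have eq: "l * (V - 1) = R2 * (R1 - 1) + D * (R1 - R2)"
    using R(3) by simp
  have R2: "R2 \<ge> 2" if "D \<ge> 0"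
  proof (rule ccontr)
    assume "\<not> R2 \<ge> 2"
    then consider "R2 = 0" | "R2 = 1" using R(5) by linarith
    then show False
    proof cases
      case 1
      then have "R1 = V + 1" using R by simp
      \<comment> \<open>Together these give \<open>V + l \<le> 0\<close>.\<close>
      then have "D * (V + 1) \<ge> V * (l + 1)" "D * (V + 1) = l * (V - 1)"
        using ge eq 1 by (simp_all add: algebra_simps)
      then show False using R by (simp add: algebra_simps)
    next
      case 2
      then have "R1 = V" using R by simp
      then have "(1 + D) * (V - 1) = l * (V - 1)"
        using eq 2 by (simp add: algebra_simps)
      then have D: "D = l - 1" using R(3) by simp
      \<comment> \<open>This forces \<open>l \<le> 0\<close>, whereas
        \<open>D = l - 1 \<ge> 0\<close> requires \<open>l \<ge> 1\<close>.\<close>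
      then have "l * V + (V - l) \<ge> V * (l + 1)" using ge 2 \<open>R1 = V\<close> by simp
      then show False using D that by (simp add: algebra_simps)
    qed
  qed
  have "4 * l \<le> V" if "D \<le> -1"
    using order_bound_negative[OF eq R(2,1,3) that] .
  moreover have "V \<le> l\<^sup>2 + l + 1" if "D \<ge> 0"
    using order_bound_nonnegative[OF eq R(2,1) R2[OF that] that] .
  ultimately show ?thesis
    unfolding ints of_nat_power[symmetric] by linarith
qed

end
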